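(* Let $G$ be a group of order $2^m$ of rank $5$ belonging to the isoclinism family $\Gamma_6$. Then (1) $\displaystyle A_G(t/|G|)=\frac{1-2^{-2}}{1-2^{-2}t} + \frac{2^{-2}-2^{-4}}{1-2^{-1}t} + \frac{2^{-4}}{1-t}$; (2) $\displaystyle B_G(t/|G|)=\frac{-2^{-1}-2^{-2}}{1-2^{-3}t} + \frac{1+2^{-1}+2^{-2}}{1-2^{-2}t}$.
   Context: For a finite group $G$ and $n\ge 0$, $\alpha_{G,n}$ denotes the number of orbits of $G$ acting on $G^n$ by simultaneous conjugation $g\cdot(x_1,\dots,x_n)=(gx_1g^{-1},\dots,gx_ng^{-1})$, and $\beta_{G,n}$ denotes the number of orbits of the same action on the set $G^{(n)}$ of $n$-tuples of pairwise commuting elements of $G$; $\alpha_{G,0}=\beta_{G,0}=1$. Set $A_G(t)=\sum_{n\ge 0}\alpha_{G,n}t^n$ and $B_G(t)=\sum_{n\ge 0}\beta_{G,n}t^n$ (formal power series, which are rational functions of $t$). $A_G(t/|G|)$, $B_G(t/|G|)$ denote the result of substituting $t/|G|$ for $t$. Finite groups $G,H$ are isoclinic if there are isomorphisms $\theta:G/Z(G)\to H/Z(H)$ and $\phi:G'\to H'$ (derived subgroups) such that $\phi([g_1,g_2])=[h_1,h_2]$ whenever $\theta(g_iZ(G))=h_iZ(H)$ for $i=1,2$. Isoclinism is an equivalence relation, whose classes are called isoclinism families. For a finite $2$-group $G$, the rank of (the family of) $G$ is the smallest $r$ such that the isoclinism family of $G$ contains a group of order $2^r$. $\Gamma_6$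 (Hall–Senior notation) is the isoclinism family, of rank 5, of the group of order $32$ $$\Gamma_6a_1=\langle \alpha,\beta_1,\beta_2 \mid \alpha^8 = \beta_1^2 = \beta_2^2 = 1,\ \beta_1\alpha\beta_1^{-1} = \alpha^{-1},\ \beta_2\alpha\beta_2^{-1} = \alpha^5 \rangle ,$$ where by convention pairs of generators for which no conjugation relation is listed commute (so $\beta_1\beta_2=\beta_2\beta_1$). $G$ belongs to $\Gamma_6$ if $G$ is a finite $2$-group isoclinic to this group. *)

theory Defs
  imports
    "HOL-Algebra.Group_Action"
    "HOL-Algebra.Generated_Groups"
    "HOL-Computational_Algebra.Formal_Power_Series"
begin

text \<open>An \<open>n\<close>-tuple over \<open>G\<close> is a list of length \<open>n\<close> with entries in the carrier; the only
  \<open>0\<close>-tuple is the empty list.\<close>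

definition group_tuples :: "('a, 'b) monoid_scheme \<Rightarrow> nat \<Rightarrow> 'a list set" where
  "group_tuples G n = {xs. length xs = n \<and> set xs \<subseteq> carrier G}"

definition commuting_tuples :: "('a, 'b) monoid_scheme \<Rightarrow> nat \<Rightarrow> 'a list set" where
  "commuting_tuples G n =
     {xs \<in> group_tuples G n. \<forall>x\<in>set xs. \<forall>y\<in>set xs. x \<otimes>\<^bsub>G\<^esub> y = y \<otimes>\<^bsub>G\<^esub> x}"

text \<open>The action is restricted to the set \<open>E\<close> of tuples acted on because the library's
  \<open>group_action\<close> is a homomorphism into \<open>BijGroup E\<close>, whose elements are
  extensional on \<open>E\<close>.\<close>

definition simul_conj ::
    "('a, 'b) monoid_scheme \<Rightarrow> 'a list set \<Rightarrow> 'a \<Rightarrow> 'a list \<Rightarrow> 'a list" where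
  "simul_conj G E = (\<lambda>g. \<lambda>xs\<in>E. map (\<lambda>x. g \<otimes>\<^bsub>G\<^esub> x \<otimes>\<^bsub>G\<^esub> inv\<^bsub>G\<^esub> g) xs)"

definition alpha :: "('a, 'b) monoid_scheme \<Rightarrow> nat \<Rightarrow> nat" where
  "alpha G n = card (orbits G (group_tuples G n) (simul_conj G (group_tuples G n)))"

definition beta :: "('a, 'b) monoid_scheme \<Rightarrow> nat \<Rightarrow> nat" where
  "beta G n = card (orbits G (commuting_tuples G n) (simul_conj G (commuting_tuples G n)))"

definition A_series :: "('a, 'b) monoid_scheme \<Rightarrow> rat fps" where
  "A_series G = Abs_fps (\<lambda>n. of_nat (alpha G n))"

definition B_series :: "('a, 'b) monoid_scheme \<Rightarrow> rat fps" where
  "B_series G = Abs_fps (\<lambda>n. of_nat (beta G n))"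

lemma (in group) group_action_simul_conj:
  assumes E: "\<And>xs. xs \<in> E \<Longrightarrow> set xs \<subseteq> carrier G"
    and closed: "\<And>g xs. g \<in> carrier G \<Longrightarrow> xs \<in> E \<Longrightarrow> map (\<lambda>x. g \<otimes> x \<otimes> inv g) xs \<in> E"
  shows "group_action G E (simul_conj G E)"
proof -
  define c where "c g xs = map (\<lambda>x. g \<otimes> x \<otimes> inv g) xs" for g xs
  have sc: "simul_conj G E g xs = c g xs" if "xs \<in> E" for g xs
    using that by (simp add: simul_conj_def c_def)
  have cE: "c g xs \<in> E" if "g \<in> carrier G" "xs \<in> E" for g xs
    using closed[OF that] by (simp add: c_def)
  have comp: "c (g \<otimes> h) xs = c g (c h xs)"
    if "g \<in> carrier G" "h \<in> carrier G" "xs \<in> E" for g h xs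
    using that E[OF that(3)] by (auto simp: c_def inv_mult_group m_assoc subset_iff)
  have one: "c \<one> xs = xs" if "xs \<in> E" for xs
    using E[OF that] unfolding c_def by (intro map_idI) auto
  have bij: "simul_conj G E g \<in> Bij E" if g: "g \<in> carrier G" for g
  proof -
    have "c (inv g) (c g xs) = xs" "c g (c (inv g) xs) = xs" if "xs \<in> E" for xs
      using comp[of "inv g" g xs] comp[of g "inv g" xs] g that one by simp_all
    hence "bij_betw (simul_conj G E g) E E"
      using g by (intro bij_betw_byWitness[where f' = "c (inv g)"]) (auto simp: sc cE)
    thus ?thesis by (simp add: Bij_def simul_conj_def)
  qed
  have mult: "simul_conj G E (g \<otimes> h) = compose E (simul_conj G E g) (simul_conj G E h)"
    if "g \<in> carrier G" "h \<in> carrier G" for g h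
  proof
    fix xs
    show "simul_conj G E (g \<otimes> h) xs = compose E (simul_conj G E g) (simul_conj G E h) xs"
    proof (cases "xs \<in> E")
      case True
      thus ?thesis using that by (simp add: compose_def sc cE comp)
    next
      case False
      thus ?thesis by (simp add: compose_def simul_conj_def)
    qed
  qed
  have "simul_conj G E \<in> hom G (BijGroup E)"
    by (rule homI) (simp_all add: BijGroup_def bij mult)
  thus ?thesis
    using group_BijGroup[of E] is_group
    by (simp add: group_action_def group_hom_def group_hom_axioms_def)
qed

lemma (in group) group_action_tuples:
  "group_action G (group_tuples G n) (simul_conj G (group_tuples G n))"
  by (rule group_action_simul_conj) (auto simp: group_tuples_def)

lemma (in group) group_action_commuting_tuples:
  "group_action G (commuting_tuples G n) (simul_conj G (commuting_tuples G n))"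
proof (rule group_action_simul_conj)
  fix g xs assume g: "g \<in> carrier G" and xs: "xs \<in> commuting_tuples G n"
  have *: "(g \<otimes> x \<otimes> inv g) \<otimes> (g \<otimes> y \<otimes> inv g) = g \<otimes> (x \<otimes> y) \<otimes> inv g"
    if "x \<in> carrier G" "y \<in> carrier G" for x y
    using that g by (metis inv_closed inv_solve_left m_assoc m_closed)
  show "map (\<lambda>x. g \<otimes> x \<otimes> inv g) xs \<in> commuting_tuples G n"
    using g xs by (auto simp: commuting_tuples_def group_tuples_def * subset_iff)
qed (auto simp: commuting_tuples_def group_tuples_def)

definition center :: "('a, 'b) monoid_scheme \<Rightarrow> 'a set" where
  "center G = {z \<in> carrier G. \<forall>g\<in>carrier G. z \<otimes>\<^bsub>G\<^esub> g = g \<otimes>\<^bsub>G\<^esub> z}"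

definition derived_group :: "('a, 'b) monoid_scheme \<Rightarrow> ('a, 'b) monoid_scheme" where
  "derived_group G = G\<lparr>carrier := derived G (carrier G)\<rparr>"

text \<open>The commutator convention is that of the library's \<open>derived_set\<close>.\<close>

definition commutator :: "('a, 'b) monoid_scheme \<Rightarrow> 'a \<Rightarrow> 'a \<Rightarrow> 'a" where
  "commutator G x y = x \<otimes>\<^bsub>G\<^esub> y \<otimes>\<^bsub>G\<^esub> inv\<^bsub>G\<^esub> x \<otimes>\<^bsub>G\<^esub> inv\<^bsub>G\<^esub> y"

definition isoclinic :: "('a, 'b) monoid_scheme \<Rightarrow> ('c, 'd) monoid_scheme \<Rightarrow> bool" where
  "isoclinic G H \<longleftrightarrow>
     (\<exists>\<theta> \<in> iso (G Mod center G) (H Mod center H).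
      \<exists>\<phi> \<in> iso (derived_group G) (derived_group H).
        \<forall>g1\<in>carrier G. \<forall>g2\<in>carrier G. \<forall>h1\<in>carrier H. \<forall>h2\<in>carrier H.
          \<theta> (center G #>\<^bsub>G\<^esub> g1) = center H #>\<^bsub>H\<^esub> h1 \<and>
          \<theta> (center G #>\<^bsub>G\<^esub> g2) = center H #>\<^bsub>H\<^esub> h2 \<longrightarrow>
          \<phi> (commutator G g1 g2) = commutator H h1 h2)"

text \<open>Every finite group is isomorphic to one whose carrier is a set of natural numbers, so
  letting \<open>H\<close> range over groups of type \<open>nat monoid\<close> loses no finite group.\<close>

definition isoclinism_rank :: "('a, 'b) monoid_scheme \<Rightarrow> nat" where
  "isoclinism_rank G =
     (LEAST r. \<exists>H :: nat monoid. group H \<and> Coset.order H = 2 ^ r \<and> isoclinic G H)"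

datatype 'x letter = Gen 'x | Inv 'x

text \<open>A relation \<open>u = v\<close> is the pair \<open>(u, v)\<close> of words. The presented group consists of the
  words modulo the least congruence that contains the relations and makes
  \<open>Inv x\<close> a two-sided inverse of \<open>Gen x\<close>.\<close>

inductive pres_eq ::
    "('x letter list \<times> 'x letter list) set \<Rightarrow> 'x letter list \<Rightarrow> 'x letter list \<Rightarrow> bool"
  for R where
  refl: "pres_eq R u u"
| sym: "pres_eq R u v \<Longrightarrow> pres_eq R v u"
| trans: "pres_eq R u v \<Longrightarrow> pres_eq R v w \<Longrightarrow> pres_eq R u w"
| mult: "pres_eq R u v \<Longrightarrow> pres_eq R u' v' \<Longrightarrow> pres_eq R (u @ u') (v @ v')"
| gen_inv: "pres_eq R [Gen x, Inv x] []"
| inv_gen: "pres_eq R [Inv x, Gen x] []"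
| rel: "(u, v) \<in> R \<Longrightarrow> pres_eq R u v"

definition word_class ::
    "('x letter list \<times> 'x letter list) set \<Rightarrow> 'x letter list \<Rightarrow> 'x letter list set" where
  "word_class R u = {v. pres_eq R u v}"

definition presented_group ::
    "('x letter list \<times> 'x letter list) set \<Rightarrow> 'x letter list set monoid" where
  "presented_group R =
     \<lparr>carrier = range (word_class R),
      monoid.mult = (\<lambda>A B. \<Union>u\<in>A. \<Union>v\<in>B. word_class R (u @ v)),
      one = word_class R []\<rparr>"

lemma word_class_eq_iff: "word_class R u = word_class R v \<longleftrightarrow> pres_eq R u v"
  unfolding word_class_def using pres_eq.refl pres_eq.sym pres_eq.trans by blast

lemma presented_group_mult [simp]:
  "word_class R u \<otimes>\<^bsub>presented_group R\<^esub> word_class R v = word_class R (u @ v)"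
proof -
  have *: "word_class R (u' @ v') = word_class R (u @ v)"
    if "u' \<in> word_class R u" "v' \<in> word_class R v" for u' v'
  proof -
    from that have "pres_eq R (u @ v) (u' @ v')"
      unfolding word_class_def mem_Collect_eq by (rule pres_eq.mult)
    thus ?thesis unfolding word_class_eq_iff by (rule pres_eq.sym)
  qed
  have mem: "u \<in> word_class R u" for u
    by (simp add: word_class_def pres_eq.refl)
  have "(\<Union>u'\<in>word_class R u. \<Union>v'\<in>word_class R v. word_class R (u' @ v')) = word_class R (u @ v)"
    using mem[of u] mem[of v] * by blast
  thus ?thesis by (simp add: presented_group_def)
qed

lemma presented_group_carrier: "carrier (presented_group R) = range (word_class R)"
  by (simp add: presented_group_def)

lemma presented_group_one: "\<one>\<^bsub>presented_group R\<^esub> = word_class R []"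
  by (simp add: presented_group_def)

lemma group_presented_group: "group (presented_group R)"
proof (rule groupI)
  fix A assume "A \<in> carrier (presented_group R)"
  then obtain u where A: "A = word_class R u" by (auto simp: presented_group_carrier)
  define inv_letter :: "'a letter \<Rightarrow> 'a letter"
    where "inv_letter = (\<lambda>l. case l of Gen x \<Rightarrow> Inv x | Inv x \<Rightarrow> Gen x)"
  have "pres_eq R (rev (map inv_letter u) @ u) []"
  proof (induction u)
    case Nil
    show ?case by (simp add: pres_eq.refl)
  next
    case (Cons l u)
    have "pres_eq R [inv_letter l, l] []"
      by (cases l) (simp_all add: inv_letter_def pres_eq.gen_inv pres_eq.inv_gen)
    hence "pres_eq R (rev (map inv_letter u) @ ([inv_letter l, l] @ u))
                     (rev (map inv_letter u) @ ([] @ u))"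
      by (intro pres_eq.mult pres_eq.refl)
    from pres_eq.trans[OF this, of "[]"] Cons show ?case by simp
  qed
  hence "word_class R (rev (map inv_letter u)) \<otimes>\<^bsub>presented_group R\<^esub> A = \<one>\<^bsub>presented_group R\<^esub>"
    by (simp add: A word_class_eq_iff presented_group_one)
  thus "\<exists>B\<in>carrier (presented_group R). B \<otimes>\<^bsub>presented_group R\<^esub> A = \<one>\<^bsub>presented_group R\<^esub>"
    unfolding presented_group_carrier by blast
qed (auto simp: presented_group_carrier presented_group_one)

datatype gamma6_gen = Al | Be1 | Be2

text \<open>Besides the listed relations there is the one saying that \<open>Be1\<close> and \<open>Be2\<close> commute:
  in the notation for these groups, generators without a listed conjugation relation
  commute.\<close>

definition Gamma6a1 :: "gamma6_gen letter list set monoid" where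
  "Gamma6a1 = presented_group
     {(replicate 8 (Gen Al), []),
      (replicate 2 (Gen Be1), []),
      (replicate 2 (Gen Be2), []),
      ([Gen Be1, Gen Al, Inv Be1], [Inv Al]),
      ([Gen Be2, Gen Al, Inv Be2], replicate 5 (Gen Al)),
      ([Gen Be1, Gen Be2], [Gen Be2, Gen Be1])}"

definition in_Gamma6 :: "('a, 'b) monoid_scheme \<Rightarrow> bool" where
  "in_Gamma6 G \<longleftrightarrow> group G \<and> (\<exists>k. Coset.order G = 2 ^ k) \<and> isoclinic G Gamma6a1"

end

theory Submission
  imports Defs
begin

text \<open>By Burnside's lemma, the \<open>n\<close>-th coefficients of \<open>A(t/|G|)\<close> and \<open>B(t/|G|)\<close> are
  the \<open>n\<close>-th moment of the normalized centralizer order and the density of commuting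
  \<open>(n + 1)\<close>-tuples. Both depend only on the commutation relation between the cosets of the
  center, so they are isoclinism invariants, and it suffices to treat \<open>Gamma6a1\<close>, the affine
  group of \<open>\<int>/8\<close>. Modulo its center, commutation becomes orthogonality for the determinant
  form on \<open>(\<int>/4)\<^sup>2\<close>: there the zero vector is orthogonal to all 16 vectors, each of the 3
  vectors of order 2 to 8 vectors, and each of the 12 vectors of order 4 to its 4 multiples.
  Counting mutually orthogonal tuples by their first entry gives \<open>7 \<cdot> 4\<^sup>n - 6 \<cdot> 2\<^sup>n\<close>.\<close>

subsection \<open>Counting cliques of a relation\<close>

definition clique_tuples :: "('a \<Rightarrow> 'a \<Rightarrow> bool) \<Rightarrow> 'a set \<Rightarrow> nat \<Rightarrow> 'a list set" where
  "clique_tuples R X n = {xs. length xs = n \<and> set xs \<subseteq> X \<and> (\<forall>x\<in>set xs. \<forall>y\<in>set xs. R x y)}"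

definition nbhd :: "('a \<Rightarrow> 'a \<Rightarrow> bool) \<Rightarrow> 'a set \<Rightarrow> 'a \<Rightarrow> 'a set" where
  "nbhd R X x = {y \<in> X. R x y}"

lemma finite_nbhd [simp]: "finite X \<Longrightarrow> finite (nbhd R X x)"
  by (simp add: nbhd_def)

lemma clique_tuples_0 [simp]: "clique_tuples R X 0 = {[]}"
  by (auto simp: clique_tuples_def)

lemma finite_clique_tuples: "finite X \<Longrightarrow> finite (clique_tuples R X n)"
  by (rule finite_subset[OF _ finite_lists_length_eq[of X n]]) (auto simp: clique_tuples_def)

text \<open>Reflexivity relates the first entry to itself, and by symmetry membership in
  \<open>nbhd R X x\<close> settles both orders of a pair.\<close>

lemma clique_tuples_Suc:
  assumes "reflp R" "symp R"
  shows "clique_tuples R X (Suc n) = (\<lambda>(x, xs). x # xs) ` (SIGMA x:X. clique_tuples R (nbhd R X x) n)"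
proof (intro Set.set_eqI iffI)
  fix zs assume "zs \<in> clique_tuples R X (Suc n)"
  then show "zs \<in> (\<lambda>(x, xs). x # xs) ` (SIGMA x:X. clique_tuples R (nbhd R X x) n)"
    by (cases zs) (auto simp: clique_tuples_def nbhd_def image_iff)
next
  fix zs assume "zs \<in> (\<lambda>(x, xs). x # xs) ` (SIGMA x:X. clique_tuples R (nbhd R X x) n)"
  then show "zs \<in> clique_tuples R X (Suc n)"
    using assms by (auto simp: clique_tuples_def nbhd_def reflp_def symp_def subset_iff)
qed

lemma card_clique_tuples_Suc:
  assumes "reflp R" "symp R" "finite X"
  shows "card (clique_tuples R X (Suc n)) = (\<Sum>x\<in>X. card (clique_tuples R (nbhd R X x) n))"
proof -
  have "inj_on (\<lambda>(x, xs). x # xs) (SIGMA x:X. clique_tuples R (nbhd R X x) n)"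
    by (auto simp: inj_on_def)
  then show ?thesis
    using assms by (simp add: clique_tuples_Suc card_image finite_clique_tuples)
qed

lemma card_clique_tuples_clique:
  assumes "finite X" "\<And>x y. x \<in> X \<Longrightarrow> y \<in> X \<Longrightarrow> R x y"
  shows "card (clique_tuples R X n) = card X ^ n"
proof -
  have "clique_tuples R X n = {xs. set xs \<subseteq> X \<and> length xs = n}"
    using assms(2) by (auto simp: clique_tuples_def)
  then show ?thesis using card_lists_length_eq[OF assms(1)] by simp
qed

section \<open>Maps whose fibres all have the same size, such as quotients by a subgroup\<close>

definition uniform_map :: "('a \<Rightarrow> 'b) \<Rightarrow> 'a set \<Rightarrow> 'b set \<Rightarrow> nat \<Rightarrow> bool" where
  "uniform_map f X Y k \<longleftrightarrow> finite X \<and> finite Y \<and> f ` X \<subseteq> Y \<and> (\<forall>y\<in>Y. card {x \<in> X. f x = y} = k)"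

lemma sum_uniform_map:
  fixes g :: "'b \<Rightarrow> nat"
  assumes "uniform_map f X Y k"
  shows "(\<Sum>x\<in>X. g (f x)) = k * (\<Sum>y\<in>Y. g y)"
proof -
  have "(\<Sum>x\<in>X. g (f x)) = (\<Sum>y\<in>Y. \<Sum>x\<in>{x \<in> X. f x = y}. g (f x))"
    using assms by (intro sum.group[symmetric]) (auto simp: uniform_map_def)
  also have "\<dots> = (\<Sum>y\<in>Y. \<Sum>x\<in>{x \<in> X. f x = y}. g y)"
    by (intro sum.cong) auto
  also have "\<dots> = (\<Sum>y\<in>Y. k * g y)"
    using assms by (intro sum.cong) (auto simp: uniform_map_def)
  finally show ?thesis by (simp add: sum_distrib_left)
qed

lemma card_uniform_map: "uniform_map f X Y k \<Longrightarrow> card X = k * card Y"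
  using sum_uniform_map[of f X Y k "\<lambda>_. 1"] by simp

lemma card_uniform_map_vimage:
  assumes "uniform_map f X Y k"
  shows "card {x \<in> X. P (f x)} = k * card {y \<in> Y. P y}"
proof -
  have count: "card {x \<in> A. Q x} = (\<Sum>x\<in>A. of_bool (Q x))" if "finite A" for A :: "'c set" and Q
    using that by (simp add: sum_of_bool_eq Int_def)
  have "finite X" "finite Y" using assms by (auto simp: uniform_map_def)
  then show ?thesis
    using sum_uniform_map[OF assms, of "\<lambda>y. of_bool (P y)"] by (simp only: count)
qed

lemma uniform_map_comp:
  assumes f: "uniform_map f X Y k" and g: "uniform_map g Y Z l"
  shows "uniform_map (\<lambda>x. g (f x)) X Z (k * l)"
  using assms card_uniform_map_vimage[OF f, of "\<lambda>y. g y = _"]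
  by (auto simp: uniform_map_def image_subset_iff)

text \<open>As \<open>R\<close> is the pullback of \<open>S\<close>, the neighbourhood of
  \<open>x\<close> is a union of full fibres of \<open>f\<close>, so restricting to it keeps the
  fibre size.\<close>

lemma uniform_map_nbhd:
  assumes "uniform_map f X Y k" and "x \<in> X"
    and R: "\<And>x y. x \<in> X \<Longrightarrow> y \<in> X \<Longrightarrow> R x y \<longleftrightarrow> S (f x) (f y)"
  shows "uniform_map f (nbhd R X x) (nbhd S Y (f x)) k"
proof -
  have "{x' \<in> nbhd R X x. f x' = y} = {x' \<in> X. f x' = y}" if "y \<in> nbhd S Y (f x)" for y
    using that assms by (auto simp: nbhd_def)
  then show ?thesis
    using assms by (auto simp: uniform_map_def nbhd_def)
qed

text \<open>Each of the \<open>n\<close> entries can be lifted in \<open>k\<close> ways. In the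
  induction \<open>X\<close> and \<open>Y\<close> stay arbitrary because the recursion on the first
  entry passes to neighbourhoods.\<close>

lemma card_clique_tuples_uniform_map:
  assumes "reflp R" "symp R" "reflp S" "symp S"
  assumes "uniform_map f X Y k"
    and "\<And>x y. x \<in> X \<Longrightarrow> y \<in> X \<Longrightarrow> R x y \<longleftrightarrow> S (f x) (f y)"
  shows "card (clique_tuples R X n) = k ^ n * card (clique_tuples S Y n)"
  using assms(5,6)
proof (induction n arbitrary: X Y)
  case 0
  then show ?case by simp
next
  case (Suc n)
  have fin: "finite X" "finite Y" using Suc.prems(1) by (auto simp: uniform_map_def)
  have "card (clique_tuples R X (Suc n)) = (\<Sum>x\<in>X. card (clique_tuples R (nbhd R X x) n))"
    using assms fin by (simp add: card_clique_tuples_Suc)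
  also have "\<dots> = (\<Sum>x\<in>X. k ^ n * card (clique_tuples S (nbhd S Y (f x)) n))"
    using Suc.prems by (intro sum.cong HOL.refl Suc.IH uniform_map_nbhd) (auto simp: nbhd_def)
  also have "\<dots> = k * (\<Sum>y\<in>Y. k ^ n * card (clique_tuples S (nbhd S Y y) n))"
    by (rule sum_uniform_map) fact
  also have "\<dots> = k ^ Suc n * card (clique_tuples S Y (Suc n))"
    using assms fin by (simp add: card_clique_tuples_Suc sum_distrib_left mult.assoc)
  finally show ?case .
qed

text \<open>The probability that a random \<open>n\<close>-tuple is a clique.\<close>

definition clique_density :: "('a \<Rightarrow> 'a \<Rightarrow> bool) \<Rightarrow> 'a set \<Rightarrow> nat \<Rightarrow> rat" where
  "clique_density R X n = of_nat (card (clique_tuples R X n)) / of_nat (card X) ^ n"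

text \<open>The mean of the \<open>n\<close>-th power of the relative degree: \<open>n\<close>
  factors of the denominator normalize the degree, one averages over \<open>X\<close>.\<close>

definition degree_moment :: "('a \<Rightarrow> 'a \<Rightarrow> bool) \<Rightarrow> 'a set \<Rightarrow> nat \<Rightarrow> rat" where
  "degree_moment R X n = of_nat (\<Sum>x\<in>X. card (nbhd R X x) ^ n) / of_nat (card X) ^ Suc n"

text \<open>Numerator and denominator acquire the same power of \<open>k\<close>:
  \<open>k ^ n\<close> for cliques, and \<open>k ^ Suc n\<close> for moments, where \<open>n\<close>
  factors come from the neighbourhood sizes and one from the choice of \<open>x\<close>.\<close>

lemma
  assumes "reflp R" "symp R" "reflp S" "symp S"
    and "uniform_map f X Y k" "0 < k"
    and R: "\<And>x y. x \<in> X \<Longrightarrow> y \<in> X \<Longrightarrow> R x y \<longleftrightarrow> S (f x) (f y)"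
  shows clique_density_uniform_map: "clique_density R X n = clique_density S Y n"
    and degree_moment_uniform_map: "degree_moment R X n = degree_moment S Y n"
proof -
  show "clique_density R X n = clique_density S Y n"
    using assms card_clique_tuples_uniform_map[of R S f X Y k n]
    by (simp add: clique_density_def card_uniform_map power_mult_distrib)
  have "(\<Sum>x\<in>X. card (nbhd R X x) ^ n) = (\<Sum>x\<in>X. (k * card (nbhd S Y (f x))) ^ n)"
    using card_uniform_map[OF uniform_map_nbhd[where R = R and S = S, OF assms(5) _ R]]
    by (intro sum.cong) auto
  also have "\<dots> = k * (\<Sum>y\<in>Y. (k * card (nbhd S Y y)) ^ n)"
    by (rule sum_uniform_map) fact
  also have "\<dots> = k ^ Suc n * (\<Sum>y\<in>Y. card (nbhd S Y y) ^ n)"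
    by (simp add: power_mult_distrib sum_distrib_left mult.assoc)
  finally show "degree_moment R X n = degree_moment S Y n"
    using assms(6) by (simp add: degree_moment_def card_uniform_map[OF assms(5)] power_mult_distrib
        del: of_nat_sum power_Suc)
qed

lemma uniform_map_bij_betw:
  assumes "bij_betw f X Y" "finite X"
  shows "uniform_map f X Y 1"
proof -
  have "{x \<in> X. f x = f z} = {z}" if "z \<in> X" for z
    using that assms(1) by (auto simp: bij_betw_def inj_on_eq_iff)
  then show ?thesis
    using assms by (auto simp: uniform_map_def bij_betw_finite bij_betw_def)
qed

text \<open>A first entry from \<open>C\<close> leaves the remaining entries unrestricted; every
  other first entry contributes the same number \<open>t\<close>. This gives a linear recurrence in
  \<open>n\<close>.\<close>

lemma card_clique_tuples_Suc_cone:
  assumes "reflp R" "symp R" "finite X" "C \<subseteq> X"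
    and "\<And>x. x \<in> C \<Longrightarrow> nbhd R X x = X"
    and "\<And>x. x \<in> X - C \<Longrightarrow> card (clique_tuples R (nbhd R X x) n) = t"
  shows "card (clique_tuples R X (Suc n)) = card C * card (clique_tuples R X n) + card (X - C) * t"
proof -
  have "card (clique_tuples R X (Suc n)) = (\<Sum>x\<in>X. card (clique_tuples R (nbhd R X x) n))"
    using assms by (simp add: card_clique_tuples_Suc)
  also have "\<dots> = (\<Sum>x\<in>X - C. t) + (\<Sum>x\<in>C. card (clique_tuples R X n))"
    using assms by (simp add: sum.subset_diff[of C X])
  finally show ?thesis by simp
qed

subsection \<open>Commuting tuples and isoclinism\<close>

definition commute :: "('a, 'b) monoid_scheme \<Rightarrow> 'a \<Rightarrow> 'a \<Rightarrow> bool" where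
  "commute G x y \<longleftrightarrow> x \<otimes>\<^bsub>G\<^esub> y = y \<otimes>\<^bsub>G\<^esub> x"

lemma reflp_commute: "reflp (commute G)" and symp_commute: "symp (commute G)"
  by (auto simp: reflp_def symp_def commute_def)

lemma commuting_tuples_eq: "commuting_tuples G n = clique_tuples (commute G) (carrier G) n"
  by (auto simp: commuting_tuples_def group_tuples_def clique_tuples_def commute_def)

section \<open>Burnside's lemma for simultaneous conjugation\<close>

lemma (in group) conj_eq_iff_commute:
  assumes "g \<in> carrier G" "x \<in> carrier G"
  shows "g \<otimes> x \<otimes> inv g = x \<longleftrightarrow> commute G g x"
proof -
  have "g \<otimes> x \<otimes> inv g = x \<longleftrightarrow> g \<otimes> x \<otimes> inv g \<otimes> g = x \<otimes> g"
    using assms by (simp only: right_cancel m_closed inv_closed)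
  also have "g \<otimes> x \<otimes> inv g \<otimes> g = g \<otimes> x"
    using assms by (simp add: m_assoc)
  finally show ?thesis unfolding commute_def .
qed

lemma (in group) simul_conj_fixed_iff:
  assumes "g \<in> carrier G" "xs \<in> E" "set xs \<subseteq> carrier G"
  shows "simul_conj G E g xs = xs \<longleftrightarrow> set xs \<subseteq> nbhd (commute G) (carrier G) g"
proof -
  have "simul_conj G E g xs = xs \<longleftrightarrow> (\<forall>x\<in>set xs. g \<otimes> x \<otimes> inv g = x)"
    using assms(2) map_eq_conv[of "\<lambda>x. g \<otimes> x \<otimes> inv g" xs "\<lambda>x. x"] by (simp add: simul_conj_def)
  then show ?thesis
    using assms conj_eq_iff_commute by (auto simp: nbhd_def)
qed

text \<open>A tuple is fixed by \<open>g\<close> exactly when all its entries centralize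
  \<open>g\<close>, so the number of fixed points is the \<open>n\<close>-th power of the order of
  the centralizer.\<close>

lemma (in group) alpha_eq_degree_moment:
  assumes "finite (carrier G)"
  shows "of_nat (alpha G n) / of_nat (order G) ^ n = degree_moment (commute G) (carrier G) n"
proof -
  interpret group_action G "group_tuples G n" "simul_conj G (group_tuples G n)"
    by (rule group_action_tuples)
  have tuples: "group_tuples G n = {xs. set xs \<subseteq> carrier G \<and> length xs = n}"
    by (auto simp: group_tuples_def)
  have "card (invariants (group_tuples G n) (simul_conj G (group_tuples G n)) g) =
      card (nbhd (commute G) (carrier G) g) ^ n" if g: "g \<in> carrier G" for g
  proof -
    have "invariants (group_tuples G n) (simul_conj G (group_tuples G n)) g =
        {xs \<in> group_tuples G n. set xs \<subseteq> nbhd (commute G) (carrier G) g}"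
      unfolding invariants_def
      by (intro Collect_cong conj_cong HOL.refl simul_conj_fixed_iff[OF g])
        (auto simp: group_tuples_def)
    also have "\<dots> = {xs. set xs \<subseteq> nbhd (commute G) (carrier G) g \<and> length xs = n}"
      by (auto simp: group_tuples_def nbhd_def)
    finally show ?thesis
      using assms by (simp add: card_lists_length_eq)
  qed
  then have "alpha G n * order G = (\<Sum>g\<in>carrier G. card (nbhd (commute G) (carrier G) g) ^ n)"
    using burnside assms by (simp add: alpha_def tuples finite_lists_length_eq)
  then have "rat_of_nat (\<Sum>g\<in>carrier G. card (nbhd (commute G) (carrier G) g) ^ n) =
      of_nat (alpha G n) * of_nat (order G)"
    by (metis of_nat_mult)
  then show ?thesis
    using assms carrier_not_empty by (simp add: degree_moment_def order_def del: of_nat_sum)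
qed

text \<open>The tuples fixed by \<open>g\<close> are the commuting \<open>n\<close>-tuples in its
  centralizer. Putting \<open>g\<close> in front turns them into commuting tuples of length
  \<open>n + 1\<close>, hence the shift to \<open>Suc n\<close>.\<close>

lemma (in group) beta_eq_clique_density:
  assumes "finite (carrier G)"
  shows "of_nat (beta G n) / of_nat (order G) ^ n =
    clique_density (commute G) (carrier G) (Suc n)"
proof -
  interpret group_action G "commuting_tuples G n" "simul_conj G (commuting_tuples G n)"
    by (rule group_action_commuting_tuples)
  have "invariants (commuting_tuples G n) (simul_conj G (commuting_tuples G n)) g =
      clique_tuples (commute G) (nbhd (commute G) (carrier G) g) n" if g: "g \<in> carrier G" for g
  proof -
    have "invariants (commuting_tuples G n) (simul_conj G (commuting_tuples G n)) g =
        {xs \<in> commuting_tuples G n. set xs \<subseteq> nbhd (commute G) (carrier G) g}"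
      unfolding invariants_def
      by (intro Collect_cong conj_cong HOL.refl simul_conj_fixed_iff[OF g])
        (auto simp: commuting_tuples_def group_tuples_def)
    also have "\<dots> = clique_tuples (commute G) (nbhd (commute G) (carrier G) g) n"
      by (auto simp: commuting_tuples_eq clique_tuples_def nbhd_def)
    finally show ?thesis .
  qed
  then have "beta G n * order G = card (clique_tuples (commute G) (carrier G) (Suc n))"
    using burnside assms
    by (simp add: beta_def commuting_tuples_eq finite_clique_tuples card_clique_tuples_Suc
        reflp_commute symp_commute)
  then have "rat_of_nat (card (clique_tuples (commute G) (carrier G) (Suc n))) =
      of_nat (beta G n) * of_nat (order G)"
    by (metis of_nat_mult)
  then show ?thesis
    using assms carrier_not_empty by (simp add: clique_density_def order_def)
qed

section \<open>Isoclinism and commutation between cosets of the center\<close>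

lemma (in group) subgroup_center: "subgroup (center G) G"
proof (rule subgroupI)
  fix z assume "z \<in> center G"
  then show "inv z \<in> center G"
    by (auto simp: center_def) (metis inv_closed inv_mult_group inv_inv)
next
  fix y z assume "y \<in> center G" "z \<in> center G"
  then have yz: "y \<in> carrier G" "z \<in> carrier G"
    and y: "\<And>g. g \<in> carrier G \<Longrightarrow> y \<otimes> g = g \<otimes> y"
    and z: "\<And>g. g \<in> carrier G \<Longrightarrow> z \<otimes> g = g \<otimes> z"
    by (auto simp: center_def)
  have "y \<otimes> z \<otimes> g = g \<otimes> (y \<otimes> z)" if g: "g \<in> carrier G" for g
  proof -
    have "y \<otimes> z \<otimes> g = y \<otimes> (g \<otimes> z)"
      using g yz by (simp only: m_assoc z)
    also have "\<dots> = (g \<otimes> y) \<otimes> z"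
      using g yz by (simp only: m_assoc[symmetric] y)
    finally show ?thesis using g yz by (simp only: m_assoc)
  qed
  then show "y \<otimes> z \<in> center G"
    using yz by (simp add: center_def)
qed (auto simp: center_def)

text \<open>The fibre over a coset is that coset itself.\<close>

lemma (in group) uniform_map_r_coset:
  assumes "subgroup K G" "finite (carrier G)"
  shows "uniform_map (\<lambda>x. K #> x) (carrier G) (rcosets K) (card K)"
proof -
  have K: "K \<subseteq> carrier G" using assms(1) by (rule subgroup.subset)
  have "{x \<in> carrier G. K #> x = A} = A" if A: "A \<in> rcosets K" for A
  proof -
    obtain a where a: "a \<in> carrier G" "A = K #> a" using A by (auto simp: RCOSETS_def)
    show ?thesis
      using a assms(1) repr_independence[of _ K a] rcos_self[of _ K] r_coset_subset_G[OF K]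
      by blast
  qed
  moreover have "card K = card A" if "A \<in> rcosets K" for A
    using that K by (rule card_rcosets_equal)
  moreover have "finite (rcosets K)"
    using assms(2) by (auto simp: RCOSETS_def)
  ultimately show ?thesis
    using assms(2) K by (auto simp: uniform_map_def rcosetsI)
qed

lemma (in group) commutator_eq_one_iff:
  assumes "x \<in> carrier G" "y \<in> carrier G"
  shows "commutator G x y = \<one> \<longleftrightarrow> commute G x y"
proof -
  have "commutator G x y = (x \<otimes> y) \<otimes> inv (y \<otimes> x)"
    using assms by (simp add: commutator_def inv_mult_group m_assoc)
  then show ?thesis
    using assms right_cancel[of "y \<otimes> x" "x \<otimes> y \<otimes> inv (y \<otimes> x)" \<one>]
    by (simp only: commute_def m_closed inv_closed one_closed l_one m_assoc[of "x \<otimes> y"] l_inv r_one)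
qed

lemma (in group) commutator_in_derived:
  assumes "x \<in> carrier G" "y \<in> carrier G"
  shows "commutator G x y \<in> derived G (carrier G)"
  unfolding derived_def commutator_def by (rule generate.incl, rule UN_I[OF assms(1)], rule UN_I[OF assms(2)], rule singletonI)

text \<open>Since \<open>\<phi>\<close> is injective and preserves the identity, a commutator in
  \<open>G\<close> is trivial iff the corresponding one in \<open>H\<close> is.\<close>

lemma isoclinic_commute_map:
  assumes "group G" "group H" "isoclinic G H"
  obtains \<theta> where "bij_betw \<theta> (rcosets\<^bsub>G\<^esub> center G) (rcosets\<^bsub>H\<^esub> center H)"
    and "\<And>g1 g2 h1 h2. g1 \<in> carrier G \<Longrightarrow> g2 \<in> carrier G \<Longrightarrow> h1 \<in> carrier H \<Longrightarrow> h2 \<in> carrier H \<Longrightarrow>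
      \<theta> (center G #>\<^bsub>G\<^esub> g1) = center H #>\<^bsub>H\<^esub> h1 \<Longrightarrow> \<theta> (center G #>\<^bsub>G\<^esub> g2) = center H #>\<^bsub>H\<^esub> h2 \<Longrightarrow>
      commute G g1 g2 \<longleftrightarrow> commute H h1 h2"
proof -
  interpret G: group G by fact
  interpret H: group H by fact
  obtain \<theta> \<phi> where \<theta>: "\<theta> \<in> iso (G Mod center G) (H Mod center H)"
    and \<phi>: "\<phi> \<in> iso (derived_group G) (derived_group H)"
    and comm: "\<And>g1 g2 h1 h2. g1 \<in> carrier G \<Longrightarrow> g2 \<in> carrier G \<Longrightarrow> h1 \<in> carrier H \<Longrightarrow> h2 \<in> carrier H \<Longrightarrow>
      \<theta> (center G #>\<^bsub>G\<^esub> g1) = center H #>\<^bsub>H\<^esub> h1 \<Longrightarrow> \<theta> (center G #>\<^bsub>G\<^esub> g2) = center H #>\<^bsub>H\<^esub> h2 \<Longrightarrow>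
      \<phi> (commutator G g1 g2) = commutator H h1 h2"
    using assms(3) unfolding isoclinic_def by blast
  have groups: "group (derived_group G)" "group (derived_group H)"
    unfolding derived_group_def
    using G.derived_is_subgroup[OF order_refl] H.derived_is_subgroup[OF order_refl]
    by (auto intro: subgroup.subgroup_is_group)
  have one: "\<phi> \<one>\<^bsub>G\<^esub> = \<one>\<^bsub>H\<^esub>"
    using hom_one[of \<phi> "derived_group G" "derived_group H"] \<phi> groups
    by (simp add: iso_def derived_group_def)
  have inj: "inj_on \<phi> (derived G (carrier G))"
    using \<phi> by (simp add: iso_def derived_group_def bij_betw_def)
  have one_derived: "\<one>\<^bsub>G\<^esub> \<in> derived G (carrier G)"
    by (simp add: derived_def generate.one)
  show ?thesis
  proof (rule that)
    show "bij_betw \<theta> (rcosets\<^bsub>G\<^esub> center G) (rcosets\<^bsub>H\<^esub> center H)"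
      using \<theta> by (simp add: iso_def FactGroup_def)
  next
    fix g1 g2 h1 h2
    assume *: "g1 \<in> carrier G" "g2 \<in> carrier G" "h1 \<in> carrier H" "h2 \<in> carrier H"
      "\<theta> (center G #>\<^bsub>G\<^esub> g1) = center H #>\<^bsub>H\<^esub> h1" "\<theta> (center G #>\<^bsub>G\<^esub> g2) = center H #>\<^bsub>H\<^esub> h2"
    have "commute G g1 g2 \<longleftrightarrow> commutator G g1 g2 = \<one>\<^bsub>G\<^esub>"
      using * by (simp add: G.commutator_eq_one_iff)
    also have "\<dots> \<longleftrightarrow> \<phi> (commutator G g1 g2) = \<phi> \<one>\<^bsub>G\<^esub>"
      using inj_on_eq_iff[OF inj G.commutator_in_derived one_derived] * by simp
    also have "\<dots> \<longleftrightarrow> commute H h1 h2"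
      using comm[OF *] one * by (simp add: H.commutator_eq_one_iff)
    finally show "commute G g1 g2 \<longleftrightarrow> commute H h1 h2" .
  qed
qed

text \<open>Both groups map uniformly onto the cosets of the center of \<open>H\<close>, and both
  commutation relations are pulled back from one relation \<open>S\<close> there. The orders of the
  two centers may differ, but they cancel.\<close>

lemma
  assumes "group G" "group H" "finite (carrier G)" "finite (carrier H)" "isoclinic G H"
  shows isoclinic_clique_density:
      "clique_density (commute G) (carrier G) n = clique_density (commute H) (carrier H) n"
    and isoclinic_degree_moment:
      "degree_moment (commute G) (carrier G) n = degree_moment (commute H) (carrier H) n"
proof -
  interpret G: group G by fact
  interpret H: group H by fact
  obtain \<theta> where bij: "bij_betw \<theta> (rcosets\<^bsub>G\<^esub> center G) (rcosets\<^bsub>H\<^esub> center H)"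
    and comm: "\<And>g1 g2 h1 h2. g1 \<in> carrier G \<Longrightarrow> g2 \<in> carrier G \<Longrightarrow> h1 \<in> carrier H \<Longrightarrow> h2 \<in> carrier H \<Longrightarrow>
      \<theta> (center G #>\<^bsub>G\<^esub> g1) = center H #>\<^bsub>H\<^esub> h1 \<Longrightarrow> \<theta> (center G #>\<^bsub>G\<^esub> g2) = center H #>\<^bsub>H\<^esub> h2 \<Longrightarrow>
      commute G g1 g2 \<longleftrightarrow> commute H h1 h2"
    using isoclinic_commute_map[OF assms(1,2,5)] by metis
  define r where "r A = (SOME h. h \<in> carrier H \<and> center H #>\<^bsub>H\<^esub> h = A)" for A
  have r: "r A \<in> carrier H \<and> center H #>\<^bsub>H\<^esub> r A = A" if "A \<in> rcosets\<^bsub>H\<^esub> center H" for A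
    unfolding r_def by (rule someI_ex) (use that in \<open>auto simp: RCOSETS_def\<close>)
  define S where "S A B \<longleftrightarrow> commute H (r A) (r B)" for A B
  have S: "reflp S" "symp S"
    by (auto simp: S_def reflp_def symp_def commute_def)
  let ?f = "\<lambda>x. \<theta> (center G #>\<^bsub>G\<^esub> x)" and ?h = "\<lambda>x. center H #>\<^bsub>H\<^esub> x"
  have coset: "uniform_map (\<lambda>x. center G #>\<^bsub>G\<^esub> x) (carrier G) (rcosets\<^bsub>G\<^esub> center G) (card (center G))"
    by (rule G.uniform_map_r_coset) (simp_all add: G.subgroup_center assms)
  have f: "uniform_map ?f (carrier G) (rcosets\<^bsub>H\<^esub> center H) (card (center G))"
    using uniform_map_comp[OF coset uniform_map_bij_betw[OF bij]] coset
    by (simp add: uniform_map_def)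
  have h: "uniform_map ?h (carrier H) (rcosets\<^bsub>H\<^esub> center H) (card (center H))"
    by (rule H.uniform_map_r_coset) (simp_all add: H.subgroup_center assms)
  have fQ: "?f x \<in> rcosets\<^bsub>H\<^esub> center H" if "x \<in> carrier G" for x
    using f that by (auto simp: uniform_map_def)
  have hQ: "?h x \<in> rcosets\<^bsub>H\<^esub> center H" if "x \<in> carrier H" for x
    using h that by (auto simp: uniform_map_def)
  have fS: "commute G x y \<longleftrightarrow> S (?f x) (?f y)" if "x \<in> carrier G" "y \<in> carrier G" for x y
    unfolding S_def using that r[OF fQ] by (intro comm) auto
  have lift: "\<exists>g\<in>carrier G. ?f g = ?h x" if x: "x \<in> carrier H" for x
  proof -
    have "?h x \<in> \<theta> ` (rcosets\<^bsub>G\<^esub> center G)"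
      using hQ[OF x] bij by (simp add: bij_betw_def)
    then show ?thesis
      unfolding RCOSETS_def by fastforce
  qed
  \<comment> \<open>Independence of the representatives chosen by \<open>r\<close>: elements of
    \<open>G\<close> lying over the cosets of \<open>x\<close> and \<open>y\<close> commute iff
    \<open>x\<close> and \<open>y\<close> do, and also iff the chosen representatives do.\<close>
  have hS: "commute H x y \<longleftrightarrow> S (?h x) (?h y)" if xy: "x \<in> carrier H" "y \<in> carrier H" for x y
  proof -
    obtain g1 g2 where g: "g1 \<in> carrier G" "?f g1 = ?h x" "g2 \<in> carrier G" "?f g2 = ?h y"
      using lift[OF xy(1)] lift[OF xy(2)] by blast
    have "commute G g1 g2 \<longleftrightarrow> commute H x y"
      using g xy by (intro comm) auto
    then show ?thesis using fS[OF g(1,3)] g by simp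
  qed
  have "finite (center G)" "finite (center H)"
    using assms(3,4) by (auto simp: center_def)
  then have k: "0 < card (center G)" "0 < card (center H)"
    using subgroup.one_closed[OF G.subgroup_center] subgroup.one_closed[OF H.subgroup_center]
    by (auto simp: card_gt_0_iff)
  show "clique_density (commute G) (carrier G) n = clique_density (commute H) (carrier H) n"
    using clique_density_uniform_map[OF reflp_commute symp_commute S f k(1) fS]
      clique_density_uniform_map[OF reflp_commute symp_commute S h k(2) hS] by simp
  show "degree_moment (commute G) (carrier G) n = degree_moment (commute H) (carrier H) n"
    using degree_moment_uniform_map[OF reflp_commute symp_commute S f k(1) fS]
      degree_moment_uniform_map[OF reflp_commute symp_commute S h k(2) hS] by simp
qed

subsection \<open>Commutation modulo the center of \<open>Gamma6a1\<close>\<close>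

definition Z4xZ4 :: "(int \<times> int) set" where "Z4xZ4 = {0,1,2,3} \<times> {0,1,2,3}"

text \<open>Vanishing of the determinant \<open>a * d - c * b\<close> modulo 4.\<close>

fun symp4 :: "int \<times> int \<Rightarrow> int \<times> int \<Rightarrow> bool" where
  "symp4 (a, b) (c, d) \<longleftrightarrow> a * d mod 4 = c * b mod 4"

lemma reflp_symp4: "reflp symp4" and symp_symp4: "symp symp4"
  by (auto simp: reflp_def symp_def)

text \<open>The vectors of order 2, which are the nonzero doubles.\<close>

definition twice4 :: "(int \<times> int) set" where "twice4 = {(0,2),(2,0),(2,2)}"

text \<open>A vector of order 4 is orthogonal exactly to its own multiples, and multiples of one
  vector are mutually orthogonal.\<close>

lemma nbhd_symp4_clique:
  "\<forall>x\<in>Z4xZ4 - {(0, 0)} - twice4. card (nbhd symp4 Z4xZ4 x) = 4 \<and>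
    (\<forall>y\<in>nbhd symp4 Z4xZ4 x. \<forall>z\<in>nbhd symp4 Z4xZ4 x. symp4 y z)"
  by code_simp

text \<open>Orthogonality to a double \<open>2v\<close> only asks the determinant with
  \<open>v\<close> to be even, which holds for half of the 16 vectors.\<close>

lemma card_nbhd_symp4_twice4: "\<forall>x\<in>twice4. card (nbhd symp4 Z4xZ4 x) = 8"
  by code_simp

lemma nbhd_symp4_twice4_central:
  "\<forall>x\<in>twice4. \<forall>y\<in>{(0, 0), x}. \<forall>z\<in>nbhd symp4 Z4xZ4 x. symp4 y z"
  by code_simp

text \<open>The vectors orthogonal to \<open>x\<close> form a copy of Z/4 x Z/2. Of the six
  \<open>y\<close> in question, the two of order 2 leave the subgroup of doubles, and the four of
  order 4 leave their own multiples.\<close>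

lemma nbhd_symp4_twice4_clique:
  "\<forall>x\<in>twice4. \<forall>y\<in>nbhd symp4 Z4xZ4 x - {(0, 0), x}.
    card (nbhd symp4 (nbhd symp4 Z4xZ4 x) y) = 4 \<and>
    (\<forall>z\<in>nbhd symp4 (nbhd symp4 Z4xZ4 x) y. \<forall>w\<in>nbhd symp4 (nbhd symp4 Z4xZ4 x) y. symp4 z w)"
  by code_simp

text \<open>With \<open>c n\<close> for the count, the first entries give
  \<open>c (n + 1) = 2 * c n + 6 * 4 ^ n\<close> and \<open>c 0 = 1\<close>, solved by
  \<open>3 * 4 ^ n - 2 * 2 ^ n\<close>. The additive form avoids subtraction of naturals.\<close>

lemma card_clique_tuples_symp4_nbhd_twice4:
  assumes "x \<in> twice4"
  shows "card (clique_tuples symp4 (nbhd symp4 Z4xZ4 x) n) + 2 * 2 ^ n = 3 * 4 ^ n"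
proof (induction n)
  case 0
  then show ?case by simp
next
  case (Suc n)
  let ?N = "nbhd symp4 Z4xZ4 x" and ?C = "{(0, 0), x}"
  have fin: "finite ?N" by (simp add: Z4xZ4_def)
  have C: "?C \<subseteq> ?N" "card ?C = 2"
    using assms by (auto simp: twice4_def Z4xZ4_def nbhd_def)
  then have card: "card (?N - ?C) = 6"
    using assms card_nbhd_symp4_twice4 by (simp add: card_Diff_subset fin)
  have "card (clique_tuples symp4 ?N (Suc n)) =
    card ?C * card (clique_tuples symp4 ?N n) + card (?N - ?C) * 4 ^ n"
  proof (rule card_clique_tuples_Suc_cone)
    fix y assume "y \<in> ?C"
    then show "nbhd symp4 ?N y = ?N"
      using nbhd_symp4_twice4_central assms by (auto simp: nbhd_def[of _ ?N])
  next
    fix y assume "y \<in> ?N - ?C"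
    then show "card (clique_tuples symp4 (nbhd symp4 ?N y) n) = 4 ^ n"
      using nbhd_symp4_twice4_clique assms card_clique_tuples_clique[of "nbhd symp4 ?N y" symp4 n] fin by auto
  qed (use fin C reflp_symp4 symp_symp4 in auto)
  then show ?case
    using Suc.IH by (simp only: C(2) card) simp
qed

lemma sum_Z4xZ4:
  fixes h :: "int \<times> int \<Rightarrow> nat"
  shows "sum h Z4xZ4 = h (0, 0) + sum h twice4 + sum h (Z4xZ4 - {(0, 0)} - twice4)"
proof -
  have "sum h Z4xZ4 = h (0, 0) + sum h (Z4xZ4 - {(0, 0)})"
    by (rule sum.remove) (auto simp: Z4xZ4_def)
  also have "sum h (Z4xZ4 - {(0, 0)}) = sum h (Z4xZ4 - {(0, 0)} - twice4) + sum h twice4"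
    by (rule sum.subset_diff) (auto simp: Z4xZ4_def twice4_def)
  finally show ?thesis by simp
qed

lemma cards_Z4xZ4:
  "card Z4xZ4 = 16" "card twice4 = 3" "card (Z4xZ4 - {(0, 0)} - twice4) = 12"
  by code_simp+

lemma nbhd_symp4_0: "nbhd symp4 Z4xZ4 (0, 0) = Z4xZ4"
  by (auto simp: nbhd_def)

text \<open>First entries of order 1, 2 and 4 give
  \<open>c (n + 1) = c n + 3 * (3 * 4 ^ n - 2 * 2 ^ n) + 12 * 4 ^ n\<close>.\<close>

lemma card_clique_tuples_symp4:
  "card (clique_tuples symp4 Z4xZ4 n) + 6 * 2 ^ n = 7 * 4 ^ n"
proof (induction n)
  case 0
  then show ?case by simp
next
  case (Suc n)
  let ?t = "\<lambda>x. card (clique_tuples symp4 (nbhd symp4 Z4xZ4 x) n)"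
  have fin: "finite Z4xZ4" by (simp add: Z4xZ4_def)
  have "card (clique_tuples symp4 Z4xZ4 (Suc n)) = sum ?t Z4xZ4"
    using fin reflp_symp4 symp_symp4 by (simp add: card_clique_tuples_Suc)
  also have "\<dots> = ?t (0, 0) + sum ?t twice4 + sum ?t (Z4xZ4 - {(0, 0)} - twice4)"
    by (rule sum_Z4xZ4)
  also have "sum ?t (Z4xZ4 - {(0, 0)} - twice4) = (\<Sum>x\<in>Z4xZ4 - {(0, 0)} - twice4. 4 ^ n)"
  proof (rule sum.cong[OF HOL.refl])
    fix x assume "x \<in> Z4xZ4 - {(0, 0)} - twice4"
    then show "?t x = 4 ^ n"
      using nbhd_symp4_clique card_clique_tuples_clique[of "nbhd symp4 Z4xZ4 x" symp4 n] fin by auto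
  qed
  finally have "card (clique_tuples symp4 Z4xZ4 (Suc n)) =
    card (clique_tuples symp4 Z4xZ4 n) + sum ?t twice4 + 12 * 4 ^ n"
    by (simp add: cards_Z4xZ4 nbhd_symp4_0)
  moreover have "sum ?t twice4 + 3 * (2 * 2 ^ n) = 3 * (3 * 4 ^ n)"
  proof -
    have "(\<Sum>x\<in>twice4. ?t x + 2 * 2 ^ n) = (\<Sum>x\<in>twice4. 3 * 4 ^ n)"
      by (intro sum.cong) (auto simp: card_clique_tuples_symp4_nbhd_twice4)
    then show ?thesis by (simp add: sum.distrib cards_Z4xZ4)
  qed
  ultimately show ?case using Suc.IH by simp
qed

text \<open>Leaves \<open>2 ^ n\<close> as the only power in the closed forms to be
  compared.\<close>

lemma powers_of_2:
  "(4 :: rat) ^ n = 2 ^ n * 2 ^ n" "(8 :: rat) ^ n = 2 ^ n * 2 ^ n * 2 ^ n"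
  "(16 :: rat) ^ n = 2 ^ n * 2 ^ n * 2 ^ n * 2 ^ n"
  by (induction n) simp_all

lemma clique_density_symp4:
  "clique_density symp4 Z4xZ4 n = 7 * (1 / 4) ^ n - 6 * (1 / 8) ^ n"
proof -
  have "of_nat (card (clique_tuples symp4 Z4xZ4 n)) = (7 * 4 ^ n - 6 * 2 ^ n :: rat)"
    using arg_cong[OF card_clique_tuples_symp4[of n], of "of_nat :: nat \<Rightarrow> rat"] by simp
  then show ?thesis
    by (simp add: clique_density_def cards_Z4xZ4 powers_of_2 field_simps)
qed

lemma degree_moment_symp4:
  "degree_moment symp4 Z4xZ4 n = 1 / 16 + 3 / 16 * (1 / 2) ^ n + 3 / 4 * (1 / 4) ^ n"
proof -
  have "(\<Sum>x\<in>Z4xZ4. card (nbhd symp4 Z4xZ4 x) ^ n) = 16 ^ n + 3 * 8 ^ n + 12 * 4 ^ n"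
    using nbhd_symp4_clique card_nbhd_symp4_twice4 by (simp add: sum_Z4xZ4 nbhd_symp4_0 cards_Z4xZ4)
  then show ?thesis
    by (simp add: degree_moment_def cards_Z4xZ4 powers_of_2 field_simps)
qed

subsection \<open>A model of \<open>Gamma6a1\<close>\<close>

definition gamma6_rels :: "(gamma6_gen letter list \<times> gamma6_gen letter list) set" where
  "gamma6_rels =
     {(replicate 8 (Gen Al), []),
      (replicate 2 (Gen Be1), []),
      (replicate 2 (Gen Be2), []),
      ([Gen Be1, Gen Al, Inv Be1], [Inv Al]),
      ([Gen Be2, Gen Al, Inv Be2], replicate 5 (Gen Al)),
      ([Gen Be1, Gen Be2], [Gen Be2, Gen Be1])}"

lemma Gamma6a1_eq: "Gamma6a1 = presented_group gamma6_rels"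
  by (simp add: Gamma6a1_def gamma6_rels_def)

text \<open>The pair \<open>(a, b)\<close> stands for the affine map \<open>x \<mapsto> b x + a\<close> of \<open>\<int>/8\<close>: the group
  \<open>Gamma6a1\<close> is the holomorph of the cyclic group of order 8.\<close>

fun aff_mult :: "int \<times> int \<Rightarrow> int \<times> int \<Rightarrow> int \<times> int" where
  "aff_mult (a, b) (c, d) = ((a + b * c) mod 8, b * d mod 8)"

definition Aff8 :: "(int \<times> int) set" where
  "Aff8 = {0, 1, 2, 3, 4, 5, 6, 7} \<times> {1, 3, 5, 7}"

text \<open>Translation by 1 and multiplication by -1 and by 5, modulo 8. The two multiplications
  are involutions, so they agree with their inverses.\<close>

fun letter_aff :: "gamma6_gen letter \<Rightarrow> int \<times> int" where
  "letter_aff (Gen Al) = (1, 1)"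
| "letter_aff (Inv Al) = (7, 1)"
| "letter_aff (Gen Be1) = (0, 7)"
| "letter_aff (Inv Be1) = (0, 7)"
| "letter_aff (Gen Be2) = (0, 5)"
| "letter_aff (Inv Be2) = (0, 5)"

definition word_aff :: "gamma6_gen letter list \<Rightarrow> int \<times> int" where
  "word_aff w = foldr (\<lambda>l. aff_mult (letter_aff l)) w (0, 1)"

lemma aff_mult_assoc: "aff_mult (aff_mult p q) r = aff_mult p (aff_mult q r)"
proof -
  have *: "(x + (y mod 8) * z) mod 8 = (x + y * z) mod 8" "(x + z * (y mod 8)) mod 8 = (x + z * y) mod 8"
    for x y z :: int
    by (metis mod_add_right_eq mod_mult_left_eq) (metis mod_add_right_eq mod_mult_right_eq)
  show ?thesis
    by (cases p; cases q; cases r) (simp add: mod_simps * distrib_left mult.assoc add.assoc)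
qed

lemma aff_mult_Aff8: "p \<in> Aff8 \<Longrightarrow> q \<in> Aff8 \<Longrightarrow> aff_mult p q \<in> Aff8"
proof -
  have "\<forall>p\<in>Aff8. \<forall>q\<in>Aff8. aff_mult p q \<in> Aff8" by code_simp
  then show "p \<in> Aff8 \<Longrightarrow> q \<in> Aff8 \<Longrightarrow> aff_mult p q \<in> Aff8" by blast
qed

lemma letter_aff_Aff8: "letter_aff l \<in> Aff8"
  by (cases l rule: letter_aff.cases) (simp_all add: Aff8_def)

lemma word_aff_Cons: "word_aff (l # w) = aff_mult (letter_aff l) (word_aff w)"
  by (simp add: word_aff_def)

lemma word_aff_Aff8: "word_aff w \<in> Aff8"
  by (induction w) (simp_all add: word_aff_Cons aff_mult_Aff8 letter_aff_Aff8, simp add: word_aff_def Aff8_def)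

lemma one_aff_mult: "p \<in> Aff8 \<Longrightarrow> aff_mult (0, 1) p = p"
  by (auto simp: Aff8_def)

lemma word_aff_append: "word_aff (u @ v) = aff_mult (word_aff u) (word_aff v)"
proof (induction u)
  case Nil
  then show ?case using one_aff_mult[OF word_aff_Aff8] by (simp add: word_aff_def)
next
  case (Cons l u)
  then show ?case by (simp add: word_aff_Cons aff_mult_assoc)
qed

text \<open>The defining relations hold for the chosen affine maps, so evaluation descends to the
  presented group.\<close>

lemma pres_eq_word_aff:
  assumes "pres_eq gamma6_rels u v"
  shows "word_aff u = word_aff v"
  using assms
proof induction
  case (gen_inv x)
  then show ?case by (cases x) (simp_all add: word_aff_def)
next
  case (inv_gen x)
  then show ?case by (cases x) (simp_all add: word_aff_def)
next
  case (rel u v)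
  then show ?case by (auto simp: gamma6_rels_def word_aff_def numeral_eq_Suc)
qed (simp_all add: word_aff_append)

lemma range_word_aff: "range word_aff = Aff8"
proof -
  \<comment> \<open>The exponent of \<open>Al\<close> gives every translation; the four tails give
    the units 1, 7, 5 and 7 * 5 = 3 modulo 8.\<close>
  have "Aff8 \<subseteq> word_aff ` set (map (\<lambda>(i, t). replicate i (Gen Al) @ t)
      (List.product [0..<8] [[], [Gen Be1], [Gen Be2], [Gen Be1, Gen Be2]]))"
    by code_simp
  then show ?thesis using word_aff_Aff8 by blast
qed

lemma card_Aff8: "card Aff8 = 32"
  by code_simp

section \<open>Normal forms in the presented group and the upper bound 32 for its order\<close>

lemma (in group) pow_mod:
  assumes "x \<in> carrier G" "x [^] (m :: nat) = \<one>"
  shows "x [^] (i :: nat) = x [^] (i mod m)"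
proof -
  have "x [^] i = x [^] (m * (i div m) + i mod m)" by simp
  also have "\<dots> = x [^] (i mod m)"
    using assms by (simp only: nat_pow_mult[symmetric] nat_pow_pow[symmetric] nat_pow_one l_one nat_pow_closed)
  finally show ?thesis .
qed

lemma (in group) pow_left_swap:
  assumes "x \<in> carrier G" "y \<in> carrier G" "y \<otimes> x = x [^] (r :: nat) \<otimes> y"
  shows "y \<otimes> x [^] (i :: nat) = x [^] (r * i) \<otimes> y"
proof (induction i)
  case 0
  then show ?case using assms by simp
next
  case (Suc i)
  have "y \<otimes> x [^] Suc i = (y \<otimes> x [^] i) \<otimes> x"
    using assms by (simp add: m_assoc)
  also have "\<dots> = x [^] (r * i) \<otimes> (y \<otimes> x)"
    using assms(1,2) by (simp add: Suc.IH m_assoc)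
  also have "\<dots> = (x [^] (r * i) \<otimes> x [^] r) \<otimes> y"
    using assms(1,2) by (simp add: assms(3) m_assoc)
  also have "x [^] (r * i) \<otimes> x [^] r = x [^] (r * Suc i)"
    using assms(1) by (simp add: nat_pow_mult add.commute)
  finally show ?case .
qed

definition (in monoid) gamma6_normal_form :: "'a \<Rightarrow> 'a \<Rightarrow> 'a \<Rightarrow> nat \<times> nat \<times> nat \<Rightarrow> 'a" where
  "gamma6_normal_form a b c = (\<lambda>(i, j, k). a [^] i \<otimes> b [^] j \<otimes> c [^] k)"

definition gamma6_exponents :: "(nat \<times> nat \<times> nat) set" where
  "gamma6_exponents = {..<8} \<times> {..<2} \<times> {..<2}"

text \<open>Moving a generator into place only changes exponents: \<open>b\<close> turns
  \<open>i\<close> into \<open>7 * i\<close> and \<open>c\<close> turns it into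
  \<open>5 * i\<close>. Inverses reduce to powers, namely \<open>a [^] 7\<close>, \<open>b\<close>
  and \<open>c\<close>.\<close>

lemma (in group) gamma6_normal_form_mult:
  assumes abc [simp]: "a \<in> carrier G" "b \<in> carrier G" "c \<in> carrier G"
    and a8: "a [^] (8 :: nat) = \<one>" and b2: "b [^] (2 :: nat) = \<one>" and c2: "c [^] (2 :: nat) = \<one>"
    and conj: "b \<otimes> a \<otimes> inv b = inv a" "c \<otimes> a \<otimes> inv c = a [^] (5 :: nat)"
    and bc: "b \<otimes> c = c \<otimes> b"
    and x: "x \<in> {a, inv a, b, inv b, c, inv c}"
    and y: "y \<in> gamma6_normal_form a b c ` gamma6_exponents"
  shows "x \<otimes> y \<in> gamma6_normal_form a b c ` gamma6_exponents"
proof -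
  let ?nf = "gamma6_normal_form a b c"
  have inv_pow: "inv g = g [^] n" if "g \<in> carrier G" "g [^] Suc n = \<one>" for g and n :: nat
    by (rule inv_equality) (use that in simp_all)
  have inva: "inv a = a [^] (7 :: nat)"
    using a8 by (intro inv_pow) simp_all
  have invb: "inv b = b"
    using inv_pow[of b 1] b2 by (simp add: numeral_2_eq_2)
  have invc: "inv c = c"
    using inv_pow[of c 1] c2 by (simp add: numeral_2_eq_2)
  have ba: "b \<otimes> a = a [^] (7 :: nat) \<otimes> b"
    using inv_solve_right[of "a [^] (7 :: nat)" "b \<otimes> a" b] conj(1) inva by simp
  have ca: "c \<otimes> a = a [^] (5 :: nat) \<otimes> c"
    using inv_solve_right[of "a [^] (5 :: nat)" "c \<otimes> a" c] conj(2) by simp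
  \<comment> \<open>The exponent 1 puts commutation into the form that \<open>pow_left_swap\<close>
    expects.\<close>
  have cb: "c \<otimes> b = b [^] (1 :: nat) \<otimes> c"
    using bc by simp
  \<comment> \<open>Exponents can be reduced modulo 8, 2 and 2, so no bounds have to be tracked
    below.\<close>
  have nf: "?nf (i, j, k) \<in> ?nf ` gamma6_exponents" for i j k
    using pow_mod[OF _ a8, of i] pow_mod[OF _ b2, of j] pow_mod[OF _ c2, of k]
    by (intro image_eqI[of _ _ "(i mod 8, j mod 2, k mod 2)"])
      (simp_all add: gamma6_normal_form_def gamma6_exponents_def)
  have a_nf: "a [^] n \<otimes> ?nf (i, j, k) = ?nf (n + i, j, k)" for i j k and n :: nat
    by (simp add: gamma6_normal_form_def m_assoc[symmetric] nat_pow_mult)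
  have b_nf: "b \<otimes> ?nf (i, j, k) = ?nf (7 * i, Suc j, k)" for i j k
  proof -
    have "b \<otimes> ?nf (i, j, k) = (b \<otimes> a [^] i) \<otimes> (b [^] j \<otimes> c [^] k)"
      by (simp add: gamma6_normal_form_def m_assoc)
    also have "\<dots> = a [^] (7 * i) \<otimes> (b \<otimes> b [^] j) \<otimes> c [^] k"
      by (simp add: pow_left_swap[OF _ _ ba] m_assoc)
    also have "b \<otimes> b [^] j = b [^] Suc j"
      by (simp only: nat_pow_Suc2 abc)
    finally show ?thesis by (simp add: gamma6_normal_form_def del: nat_pow_Suc)
  qed
  have c_nf: "c \<otimes> ?nf (i, j, k) = ?nf (5 * i, j, Suc k)" for i j k
  proof -
    have "c \<otimes> ?nf (i, j, k) = (c \<otimes> a [^] i) \<otimes> (b [^] j \<otimes> c [^] k)"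
      by (simp add: gamma6_normal_form_def m_assoc)
    also have "\<dots> = a [^] (5 * i) \<otimes> ((c \<otimes> b [^] j) \<otimes> c [^] k)"
      by (simp add: pow_left_swap[OF _ _ ca] m_assoc)
    also have "c \<otimes> b [^] j = b [^] j \<otimes> c"
      using pow_left_swap[OF _ _ cb, of j] by simp
    also have "b [^] j \<otimes> c \<otimes> c [^] k = b [^] j \<otimes> c [^] Suc k"
      by (simp only: nat_pow_Suc2 abc m_assoc nat_pow_closed)
    finally show ?thesis by (simp add: gamma6_normal_form_def m_assoc del: nat_pow_Suc)
  qed
  obtain i j k where y: "y = ?nf (i, j, k)" using y by auto
  have "x \<in> {a [^] (1 :: nat), a [^] (7 :: nat), b, c}"
    using x inva invb invc by auto
  then show ?thesis
    unfolding y using a_nf b_nf c_nf nf by (elim insertE emptyE) (simp_all only:)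
qed

text \<open>Starting from the empty word and prepending letters never leaves the set of normal
  forms.\<close>

lemma carrier_Gamma6a1:
  obtains a b c where
    "carrier Gamma6a1 \<subseteq> monoid.gamma6_normal_form Gamma6a1 a b c ` gamma6_exponents"
proof -
  interpret group Gamma6a1
    unfolding Gamma6a1_eq by (rule group_presented_group)
  let ?w = "word_class gamma6_rels"
  define a b c where "a = ?w [Gen Al]" and "b = ?w [Gen Be1]" and "c = ?w [Gen Be2]"
  note abc_def = a_def b_def c_def
  have carr [simp]: "?w u \<in> carrier Gamma6a1" for u
    by (simp add: Gamma6a1_eq presented_group_carrier)
  have mult: "?w u \<otimes>\<^bsub>Gamma6a1\<^esub> ?w v = ?w (u @ v)" for u v
    by (simp add: Gamma6a1_eq)
  have one: "\<one>\<^bsub>Gamma6a1\<^esub> = ?w []"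
    by (simp add: Gamma6a1_eq presented_group_one)
  have rel: "?w u = ?w v" if "(u, v) \<in> gamma6_rels" for u v
    using that by (simp add: word_class_eq_iff pres_eq.rel)
  have pow: "?w [l] [^]\<^bsub>Gamma6a1\<^esub> n = ?w (replicate n l)" for l and n :: nat
    by (induction n) (simp_all add: mult one replicate_append_same)
  have inv: "inv\<^bsub>Gamma6a1\<^esub> ?w [Gen x] = ?w [Inv x]" for x
    by (rule inv_equality)
      (simp_all add: mult one word_class_eq_iff pres_eq.inv_gen)
  have step: "?w [l] \<otimes>\<^bsub>Gamma6a1\<^esub> y \<in> gamma6_normal_form a b c ` gamma6_exponents"
    if "y \<in> gamma6_normal_form a b c ` gamma6_exponents" for l y
  proof (rule gamma6_normal_form_mult[OF _ _ _ _ _ _ _ _ _ _ that])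
    show "?w [l] \<in> {a, inv\<^bsub>Gamma6a1\<^esub> a, b, inv\<^bsub>Gamma6a1\<^esub> b, c, inv\<^bsub>Gamma6a1\<^esub> c}"
      by (cases l rule: letter_aff.cases) (simp_all add: abc_def inv)
  \<comment> \<open>Rewritten in terms of word classes, each remaining hypothesis is a carrier
    membership or a defining relation.\<close>
  qed (unfold abc_def inv pow mult one, (rule carr | rule rel, simp add: gamma6_rels_def)+)
  have "?w w \<in> gamma6_normal_form a b c ` gamma6_exponents" for w
  proof (induction w)
    case Nil
    have "?w [] = gamma6_normal_form a b c (0, 0, 0)"
      by (simp add: gamma6_normal_form_def abc_def flip: one)
    then show ?case by (rule image_eqI) (simp add: gamma6_exponents_def)
  next
    case (Cons l w)
    then show ?case using step[OF Cons.IH, of l] by (simp add: mult)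
  qed
  then have "carrier Gamma6a1 \<subseteq> gamma6_normal_form a b c ` gamma6_exponents"
    by (auto simp: Gamma6a1_eq presented_group_carrier)
  then show ?thesis by (rule that)
qed

section \<open>Identification with the affine group of Z/8\<close>

definition class_aff :: "gamma6_gen letter list set \<Rightarrow> int \<times> int" where
  "class_aff A = the_elem (word_aff ` A)"

lemma class_aff_word_class [simp]: "class_aff (word_class gamma6_rels w) = word_aff w"
proof -
  have "word_aff ` word_class gamma6_rels w = {word_aff w}"
    using pres_eq.refl by (force simp: word_class_def dest: pres_eq_word_aff)
  then show ?thesis by (simp add: class_aff_def)
qed

lemma finite_Gamma6a1: "finite (carrier Gamma6a1)"
  and card_Gamma6a1_le: "card (carrier Gamma6a1) \<le> 32"
proof -
  obtain a b c where
    sub: "carrier Gamma6a1 \<subseteq> monoid.gamma6_normal_form Gamma6a1 a b c ` gamma6_exponents"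
    by (rule carrier_Gamma6a1)
  have fin: "finite gamma6_exponents" and card: "card gamma6_exponents = 32"
    by (simp_all add: gamma6_exponents_def card_cartesian_product)
  show "finite (carrier Gamma6a1)"
    using sub fin by (meson finite_imageI finite_subset)
  show "card (carrier Gamma6a1) \<le> 32"
    using surj_card_le[OF fin sub] card by simp
qed

text \<open>Evaluation maps at most 32 elements onto 32, so it is injective; this rules out any
  further collapse or excess in the presentation.\<close>

lemma bij_betw_class_aff: "bij_betw class_aff (carrier Gamma6a1) Aff8"
proof -
  have image: "class_aff ` carrier Gamma6a1 = Aff8"
    by (simp add: Gamma6a1_eq presented_group_carrier image_image range_word_aff)
  have "card (class_aff ` carrier Gamma6a1) \<le> card (carrier Gamma6a1)"
    by (rule card_image_le[OF finite_Gamma6a1])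
  then have "card (class_aff ` carrier Gamma6a1) = card (carrier Gamma6a1)"
    using card_Gamma6a1_le by (simp add: image card_Aff8)
  then show ?thesis
    unfolding bij_betw_def using eq_card_imp_inj_on[OF finite_Gamma6a1] image by blast
qed

lemma commute_Gamma6a1:
  assumes "A \<in> carrier Gamma6a1" "B \<in> carrier Gamma6a1"
  shows "commute Gamma6a1 A B \<longleftrightarrow>
    aff_mult (class_aff A) (class_aff B) = aff_mult (class_aff B) (class_aff A)"
proof -
  obtain u v where uv: "A = word_class gamma6_rels u" "B = word_class gamma6_rels v"
    using assms by (auto simp: Gamma6a1_eq presented_group_carrier)
  have "commute Gamma6a1 A B \<longleftrightarrow> word_class gamma6_rels (u @ v) = word_class gamma6_rels (v @ u)"
    by (simp add: commute_def uv Gamma6a1_eq)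
  also have "\<dots> \<longleftrightarrow> word_aff (u @ v) = word_aff (v @ u)"
    using inj_on_eq_iff[OF bij_betw_imp_inj_on[OF bij_betw_class_aff],
        of "word_class gamma6_rels (u @ v)" "word_class gamma6_rels (v @ u)"]
    by (simp add: Gamma6a1_eq presented_group_carrier)
  finally show ?thesis by (simp add: uv word_aff_append)
qed

text \<open>Writing units as \<open>1 + 2u\<close>, the maps \<open>(v, 1 + 2u)\<close> and \<open>(w, 1 + 2t)\<close> commute
  iff \<open>2uw \<equiv> 2tv\<close> modulo 8, that is, \<open>uw \<equiv> tv\<close> modulo 4.\<close>

fun aff_symp :: "int \<times> int \<Rightarrow> int \<times> int" where
  "aff_symp (v, u) = (v mod 4, (u - 1) div 2)"

text \<open>Each fibre is a pair \<open>(v, b)\<close>, \<open>(v + 4, b)\<close> with the first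
  entry taken modulo 8: a coset of the center, which is generated by the translation by 4. The map
  is not a homomorphism to (Z/4)^2; only its fibres and the relation count.\<close>

lemma uniform_map_aff_symp: "uniform_map aff_symp Aff8 Z4xZ4 2"
proof -
  have "finite Aff8" "finite Z4xZ4" by (simp_all add: Aff8_def Z4xZ4_def)
  moreover have "aff_symp ` Aff8 \<subseteq> Z4xZ4" by code_simp
  moreover have "\<forall>y\<in>Z4xZ4. card {x \<in> Aff8. aff_symp x = y} = 2" by code_simp
  ultimately show ?thesis by (simp add: uniform_map_def)
qed

lemma aff_mult_commute_iff:
  assumes "p \<in> Aff8" "q \<in> Aff8"
  shows "aff_mult p q = aff_mult q p \<longleftrightarrow> symp4 (aff_symp p) (aff_symp q)"
proof -
  have "\<forall>p\<in>Aff8. \<forall>q\<in>Aff8. aff_mult p q = aff_mult q p \<longleftrightarrow> symp4 (aff_symp p) (aff_symp q)"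
    by code_simp
  then show ?thesis using assms by blast
qed

lemma uniform_map_Gamma6a1: "uniform_map (\<lambda>A. aff_symp (class_aff A)) (carrier Gamma6a1) Z4xZ4 2"
  using uniform_map_comp[OF uniform_map_bij_betw[OF bij_betw_class_aff finite_Gamma6a1]
      uniform_map_aff_symp] by simp

lemma commute_Gamma6a1_symp4:
  assumes "A \<in> carrier Gamma6a1" "B \<in> carrier Gamma6a1"
  shows "commute Gamma6a1 A B \<longleftrightarrow> symp4 (aff_symp (class_aff A)) (aff_symp (class_aff B))"
  using commute_Gamma6a1[OF assms] aff_mult_commute_iff assms bij_betwE[OF bij_betw_class_aff]
  by blast

section \<open>Generating functions\<close>

lemma fps_const_divide_geometric:
  "fps_const a / (1 - fps_const b * fps_X) = Abs_fps (\<lambda>n. a * b ^ n)" for a b :: "'a :: field"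
proof -
  have "Abs_fps (\<lambda>n. a * b ^ n) * (1 - fps_const b * fps_X) = fps_const a"
  proof (rule fps_ext)
    fix n
    have "Abs_fps (\<lambda>n. a * b ^ n) * (1 - fps_const b * fps_X) =
        Abs_fps (\<lambda>n. a * b ^ n) - fps_const b * (Abs_fps (\<lambda>n. a * b ^ n) * fps_X)"
      by (simp add: algebra_simps)
    then show "fps_nth (Abs_fps (\<lambda>n. a * b ^ n) * (1 - fps_const b * fps_X)) n = fps_nth (fps_const a) n"
      by (cases n) simp_all
  qed
  moreover have "fps_nth (1 - fps_const b * fps_X) 0 = 1" by simp
  then have "1 - fps_const b * fps_X \<noteq> 0" by (metis fps_zero_nth zero_neq_one)
  ultimately show ?thesis by (metis nonzero_mult_div_cancel_right)
qed

theorem lemma5p16: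
  fixes G :: "('a, 'b) monoid_scheme" and m :: nat
  assumes "group G"
    and "Coset.order G = 2 ^ m"
    and "isoclinism_rank G = 5"
    and "in_Gamma6 G"
  shows "(A_series G oo (fps_const (1 / of_nat (Coset.order G)) * fps_X) =
           fps_const (1 - 1 / 2 ^ 2) / (1 - fps_const (1 / 2 ^ 2) * fps_X)
         + fps_const (1 / 2 ^ 2 - 1 / 2 ^ 4) / (1 - fps_const (1 / 2) * fps_X)
         + fps_const (1 / 2 ^ 4) / (1 - fps_X)) \<and>
        (B_series G oo (fps_const (1 / of_nat (Coset.order G)) * fps_X) =
           fps_const (- 1 / 2 - 1 / 2 ^ 2) / (1 - fps_const (1 / 2 ^ 3) * fps_X)
         + fps_const (1 + 1 / 2 + 1 / 2 ^ 2) / (1 - fps_const (1 / 2 ^ 2) * fps_X))"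
proof -
  interpret group G by fact
  \<comment> \<open>\<open>order\<close> is a cardinality and would be 0 for an infinite
    carrier.\<close>
  have fin: "finite (carrier G)"
    using assms(2) order_gt_0_iff_finite by simp
  have Gamma: "group Gamma6a1"
    unfolding Gamma6a1_eq by (rule group_presented_group)
  have iso: "isoclinic G Gamma6a1"
    using assms(4) by (simp add: in_Gamma6_def)
  note iso_Gamma = assms(1) Gamma fin finite_Gamma6a1 iso
  note Gamma_symp4 = reflp_commute symp_commute reflp_symp4 symp_symp4
    uniform_map_Gamma6a1 zero_less_numeral commute_Gamma6a1_symp4
  have "of_nat (alpha G n) / of_nat (order G) ^ n = degree_moment symp4 Z4xZ4 n" for n
    using alpha_eq_degree_moment[OF fin] isoclinic_degree_moment[OF iso_Gamma]
      degree_moment_uniform_map[OF Gamma_symp4] by simp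
  then have A: "of_nat (alpha G n) / of_nat (order G) ^ n =
      1 / 16 + 3 / 16 * (1 / 2) ^ n + 3 / 4 * (1 / 4 :: rat) ^ n" for n
    by (simp only: degree_moment_symp4)
  have "of_nat (beta G n) / of_nat (order G) ^ n = clique_density symp4 Z4xZ4 (Suc n)" for n
    using beta_eq_clique_density[OF fin] isoclinic_clique_density[OF iso_Gamma]
      clique_density_uniform_map[OF Gamma_symp4] by simp
  then have B: "of_nat (beta G n) / of_nat (order G) ^ n =
      7 * (1 / 4) ^ Suc n - 6 * (1 / 8 :: rat) ^ Suc n" for n
    by (simp only: clique_density_symp4)
  \<comment> \<open>Makes the last summand of the first formula a geometric series of ratio
    1.\<close>
  have one: "(1 :: rat fps) - fps_X = 1 - fps_const 1 * fps_X" by simp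
  have "A_series G oo (fps_const (1 / of_nat (order G)) * fps_X) =
      Abs_fps (\<lambda>n. 1 / 16 + 3 / 16 * (1 / 2) ^ n + 3 / 4 * (1 / 4) ^ n)"
    \<comment> \<open>The substitution divides the \<open>n\<close>-th coefficient by the
      \<open>n\<close>-th power of the group order.\<close>
    unfolding A[symmetric] by (simp add: fps_compose_linear A_series_def power_divide)
  moreover have "B_series G oo (fps_const (1 / of_nat (order G)) * fps_X) =
      Abs_fps (\<lambda>n. 7 * (1 / 4) ^ Suc n - 6 * (1 / 8) ^ Suc n)"
    unfolding B[symmetric] by (simp add: fps_compose_linear B_series_def power_divide)
  \<comment> \<open>Coefficients are compared; the shift by one turns 7 and 6 into 7/4 = 1 + 1/2 +
    1/4 and 6/8 = 1/2 + 1/4.\<close>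
  ultimately show ?thesis
    unfolding one fps_const_divide_geometric by (simp add: fps_eq_iff)
qed

end
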